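(* Let $w$ be an infinite word over a three-letter alphabet $\mathcal{A}$ that admits letter frequencies. If there exists a positive integer $k$ such that $\rho_w(kn) \leq 3$ for every positive integer $n$, then the letter frequencies of $w$ are rationally dependent, i.e. the three real numbers $(f_w(i))_{i \in \mathcal{A}}$ are linearly dependent over $\mathbb{Q}$.
   Context: An infinite word over a finite alphabet $\mathcal{A}$ is a sequence $w = w[0]w[1]w[2]\cdots \in \mathcal{A}^{\mathbb{N}}$. For a finite word $u$ and a letter $i$, $|u|_i$ denotes the number of occurrences of $i$ in $u$, and $\mathrm{pref}_n(w)$ denotes the prefix of length $n$ of $w$. The word $w$ admits letter frequencies if for each $i \in \mathcal{A}$ the limit $f_w(i) = \lim_{n\to\infty} |\mathrm{pref}_n(w)|_i / n$ exists. The letter frequencies are rationally independent if $(f_w(i))_{i\in\mathcal{A}}$ are linearly independent over $\mathbb{Q}$, and rationally dependent otherwise. Two finite words are abelian equivalent if one is a permutation (anagram) of the other, i.e. they have the same number of occurrences of every letter. For $n \geq 1$, $\mathcal{L}_n(w)$ is the set of length-$n$ factors (contiguous subwords) of $w$, and the abelian complexity is $\rho_w(n) = \mathrm{card}\,(\mathcal{L}_n(w)/\sim_{ab})$, the number of abelian equivalence classes of length-$n$ factors of $w$. *)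

theory Defs
  imports "HOL-Analysis.Analysis" "HOL-Library.Omega_Words_Fun"
begin

definition admits_letter_frequencies :: "'a set \<Rightarrow> 'a word \<Rightarrow> bool" where
  "admits_letter_frequencies A w \<longleftrightarrow>
     (\<forall>i\<in>A. convergent (\<lambda>n. real (count_list (prefix n w) i) / real n))"

definition letter_freq :: "'a word \<Rightarrow> 'a \<Rightarrow> real" where
  "letter_freq w i = lim (\<lambda>n. real (count_list (prefix n w) i) / real n)"

text \<open>
  Dependence of the family \<open>(f i)\<close> indexed by a finite set \<open>A\<close>, as opposed to dependence of the
  set \<open>f ` A\<close>: a family with a repeated value is dependent.
\<close>

definition rationally_dependent :: "'a set \<Rightarrow> ('a \<Rightarrow> real) \<Rightarrow> bool" where
  "rationally_dependent A f \<longleftrightarrow>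
     (\<exists>q :: 'a \<Rightarrow> rat. (\<exists>i\<in>A. q i \<noteq> 0) \<and> (\<Sum>i\<in>A. of_rat (q i) * f i) = 0)"

lemma rationally_dependent_iff:
  assumes "finite A"
  shows "rationally_dependent A f \<longleftrightarrow>
    \<not> inj_on f A \<or> module.dependent (\<lambda>(q::rat) (x::real). of_rat q * x) (f ` A)"
proof -
  interpret rv: vector_space "\<lambda>(q::rat) (x::real). of_rat q * x"
    by unfold_locales (auto simp: algebra_simps of_rat_add of_rat_mult)
  show ?thesis
  proof (cases "inj_on f A")
    case True
    have "rv.dependent (f ` A) \<longleftrightarrow>
      (\<exists>u. (\<exists>i\<in>A. u (f i) \<noteq> 0) \<and> (\<Sum>i\<in>A. of_rat (u (f i)) * f i) = 0)"
      using assms True by (simp add: rv.dependent_finite sum.reindex)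
    also have "\<dots> \<longleftrightarrow> rationally_dependent A f"
      unfolding rationally_dependent_def
    proof (intro iffI; elim exE conjE)
      fix u assume "\<exists>i\<in>A. u (f i) \<noteq> 0" "(\<Sum>i\<in>A. of_rat (u (f i)) * f i) = 0"
      then show "\<exists>q::_ \<Rightarrow> rat. (\<exists>i\<in>A. q i \<noteq> 0) \<and> (\<Sum>i\<in>A. of_rat (q i) * f i) = 0"
        by (intro exI[of _ "u \<circ> f"]) simp
    next
      fix q :: "'a \<Rightarrow> rat"
      assume "\<exists>i\<in>A. q i \<noteq> 0" "(\<Sum>i\<in>A. of_rat (q i) * f i) = 0"
      then show "\<exists>u. (\<exists>i\<in>A. u (f i) \<noteq> 0) \<and> (\<Sum>i\<in>A. of_rat (u (f i)) * f i) = 0"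
        using True by (intro exI[of _ "\<lambda>x. q (inv_into A f x)"]) simp
    qed
    finally show ?thesis using True by simp
  next
    case False
    then obtain a b where ab: "a \<in> A" "b \<in> A" "a \<noteq> b" "f a = f b"
      by (auto simp: inj_on_def)
    define q :: "'a \<Rightarrow> rat" where "q = (\<lambda>i. if i = a then 1 else if i = b then - 1 else 0)"
    have "(\<Sum>i\<in>A. of_rat (q i) * f i) = (\<Sum>i\<in>{a, b}. of_rat (q i) * f i)"
      using ab assms by (intro sum.mono_neutral_right) (auto simp: q_def)
    also have "\<dots> = 0" using ab by (simp add: q_def)
    finally have "rationally_dependent A f"
      unfolding rationally_dependent_def using ab by (intro exI[of _ q]) (auto simp: q_def)
    then show ?thesis using False by simp
  qed
qed

definition factors :: "'a word \<Rightarrow> nat \<Rightarrow> 'a list set" where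
  "factors w n = {subsequence w i (i + n) | i. True}"

definition abelian_equiv :: "'a list \<Rightarrow> 'a list \<Rightarrow> bool" where
  "abelian_equiv u v \<longleftrightarrow> mset u = mset v"

definition abelian_complexity :: "'a word \<Rightarrow> nat \<Rightarrow> nat" where
  "abelian_complexity w n =
     card (factors w n // {(u, v) \<in> factors w n \<times> factors w n. abelian_equiv u v})"

end

theory Submission
  imports Defs
begin

text \<open>
  Let \<open>P n\<close> count two of the letters in the prefix of length \<open>n\<close>, and suppose the frequencies
  \<open>(f, g)\<close> of these letters are rationally independent of 1. For \<open>k dvd m\<close> the displacements
  \<open>D m i = P (i + m) - P i\<close> take at most three values. Their mean is \<open>m (f, g)\<close>, so independence
  keeps them off every rational line, and consecutive displacements are neighbours in the triangular
  lattice: the values are the vertices of a unimodular triangle around \<open>m (f, g)\<close>, and the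
  proportion of each vertex is an area coordinate.

  When \<open>m (f, g)\<close> is close to a lattice point \<open>p\<close>, this point is a vertex, so the values are
  \<open>p\<close>, \<open>p + a\<close>, \<open>p + b\<close> with \<open>p\<close> by far the most frequent. Adding a much smaller displacement
  \<open>D m'\<close> does not change the triangle, so the edges of the small triangle are differences of
  vertices of the large one. Some \<open>a\<close> occurs at arbitrarily small scales; for
  \<open>m (f, g) - p\<close> almost parallel to \<open>a\<close> (Kronecker) this forces \<open>a\<close> to be an edge at \<open>p\<close>, and the
  other edge \<open>b\<close> may be taken constant. Fix such an \<open>m1\<close> and take a much smaller \<open>m2\<close>, almost
  parallel to \<open>a\<close>. Start at an \<open>i\<close> with \<open>D m1 i = p1 + b\<close> after which \<open>D m2\<close> avoids \<open>p2 + b\<close> for a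
  long time, which exists as \<open>b\<close> is rare in \<open>D m2\<close>. Comparing the two orders of summation in
  \<open>D (m1 + m2)\<close> shows that \<open>D m2\<close> stays equal to \<open>p2\<close> during that time, so \<open>D (J * m2) i = J p2\<close>
  strays too far from its mean.
\<close>

section \<open>Means of sequences\<close>

text \<open>For an indicator \<open>of_bool (A i)\<close> this is the natural density of the set
  where \<open>A\<close> holds.\<close>

definition has_mean :: "(nat \<Rightarrow> real) \<Rightarrow> real \<Rightarrow> bool" where
  "has_mean \<phi> x \<longleftrightarrow> (\<lambda>N. (\<Sum>i<N. \<phi> i) / real N) \<longlonglongrightarrow> x"

lemma has_mean_const: "has_mean (\<lambda>_. c) c"
proof -
  have "\<forall>\<^sub>F N in sequentially. c = (\<Sum>i<N. c) / real N"
    using eventually_gt_at_top[of 0] by eventually_elim auto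
  then show ?thesis
    unfolding has_mean_def by (rule Lim_transform_eventually[OF tendsto_const])
qed

lemma has_mean_add:
  "has_mean \<phi> x \<Longrightarrow> has_mean \<psi> y \<Longrightarrow> has_mean (\<lambda>i. \<phi> i + \<psi> i) (x + y)"
  unfolding has_mean_def sum.distrib add_divide_distrib by (rule tendsto_add)

lemma has_mean_cmult: "has_mean \<phi> x \<Longrightarrow> has_mean (\<lambda>i. c * \<phi> i) (c * x)"
  unfolding has_mean_def sum_distrib_left[symmetric] times_divide_eq_right[symmetric]
  by (rule tendsto_mult_left)

lemma has_mean_sum:
  "(\<And>j. j \<in> J \<Longrightarrow> has_mean (\<phi> j) (x j)) \<Longrightarrow> has_mean (\<lambda>i. \<Sum>j\<in>J. \<phi> j i) (\<Sum>j\<in>J. x j)"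
proof (induction J rule: infinite_finite_induct)
  case (insert j J)
  then show ?case by (simp add: has_mean_add)
qed (simp_all add: has_mean_const)

lemma has_mean_unique: "has_mean \<phi> x \<Longrightarrow> has_mean \<phi> y \<Longrightarrow> x = y"
  unfolding has_mean_def by (rule LIMSEQ_unique)

lemma has_mean_mono:
  assumes "has_mean \<phi> x" "has_mean \<psi> y" "\<And>i. \<phi> i \<le> \<psi> i"
  shows "x \<le> y"
  using assms unfolding has_mean_def
  by (intro LIMSEQ_le[of _ x _ y]) (auto intro!: divide_right_mono sum_mono)

text \<open>Replacing the denominator \<open>N + s\<close> by \<open>N\<close> costs a factor
  \<open>1 + s / N\<close>, which tends to 1.\<close>

lemma LIMSEQ_div_shift:
  assumes "(\<lambda>N. h N / real N) \<longlonglongrightarrow> c"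
  shows "(\<lambda>N. h (N + s) / real N) \<longlonglongrightarrow> (c :: real)"
proof -
  have 1: "(\<lambda>N. h (N + s) / real (N + s)) \<longlonglongrightarrow> c"
    using assms by (rule LIMSEQ_ignore_initial_segment)
  have "(\<lambda>N. 1 + real s * (1 / real N)) \<longlonglongrightarrow> 1 + real s * 0"
    by (intro tendsto_intros lim_1_over_n)
  with 1 have "(\<lambda>N. h (N + s) / real (N + s) * (1 + real s * (1 / real N))) \<longlonglongrightarrow> c * 1"
    by (intro tendsto_mult) auto
  moreover have "\<forall>\<^sub>F N in sequentially.
      h (N + s) / real (N + s) * (1 + real s * (1 / real N)) = h (N + s) / real N"
    using eventually_gt_at_top[of 0]
  proof eventually_elim
    case (elim N)
    then have "1 + real s * (1 / real N) = real (N + s) / real N" by (simp add: field_simps)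
    then show ?case using elim by simp
  qed
  ultimately show ?thesis
    using Lim_transform_eventually by fastforce
qed

lemma has_mean_shift:
  assumes "has_mean \<phi> x" shows "has_mean (\<lambda>i. \<phi> (i + s)) x"
proof -
  have eq: "(\<Sum>i<N. \<phi> (i + s)) = (\<Sum>i<N + s. \<phi> i) - (\<Sum>i<s. \<phi> i)" for N
    by (induction N) auto
  have "(\<lambda>N. (\<Sum>i<N + s. \<phi> i) / real N - (\<Sum>i<s. \<phi> i) * (1 / real N))
      \<longlonglongrightarrow> x - (\<Sum>i<s. \<phi> i) * 0"
    using assms unfolding has_mean_def
    by (intro tendsto_diff tendsto_mult tendsto_const lim_1_over_n LIMSEQ_div_shift)
  then show ?thesis
    unfolding has_mean_def eq by (simp add: diff_divide_distrib)
qed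

text \<open>The unit increments telescope and have mean \<open>c\<close>; \<open>m\<close> shifted
  copies of them add up to the increment of length \<open>m\<close>.\<close>

lemma has_mean_difference:
  assumes "(\<lambda>n. h n / real n) \<longlonglongrightarrow> c"
  shows "has_mean (\<lambda>i. h (i + m) - h i) (real m * c)"
proof (induction m)
  case 0
  then show ?case using has_mean_const[of 0] by simp
next
  case (Suc m)
  have "(\<lambda>N. h N / real N - h 0 * (1 / real N)) \<longlonglongrightarrow> c - h 0 * 0"
    by (intro tendsto_diff tendsto_mult tendsto_const lim_1_over_n assms)
  then have "has_mean (\<lambda>i. h (Suc i) - h i) c"
    by (simp add: has_mean_def sum_lessThan_telescope diff_divide_distrib)
  then have "has_mean (\<lambda>i. h (Suc (i + m)) - h (i + m)) c"
    by (rule has_mean_shift)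
  from has_mean_add[OF this Suc] show ?case
    by (simp add: algebra_simps)
qed

text \<open>Union bound for densities: otherwise the indicator of \<open>A\<close> is dominated
  pointwise by the sum of the indicators of the \<open>B j\<close>.\<close>

lemma has_mean_ex:
  assumes A: "has_mean (\<lambda>i. of_bool (A i)) x"
    and B: "\<And>j. j \<in> J \<Longrightarrow> has_mean (\<lambda>i. of_bool (B j i)) (y j)"
    and fin: "finite J" and less: "(\<Sum>j\<in>J. y j) < x"
  shows "\<exists>i. A i \<and> (\<forall>j\<in>J. \<not> B j i)"
proof (rule ccontr)
  assume neg: "\<not> ?thesis"
  have "x \<le> (\<Sum>j\<in>J. y j)"
  proof (rule has_mean_mono[OF A has_mean_sum[OF B]])
    fix i
    show "of_bool (A i) \<le> (\<Sum>j\<in>J. of_bool (B j i) :: real)"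
    proof (cases "A i")
      case True
      then obtain j where j: "j \<in> J" "B j i" using neg by blast
      have "of_bool (B j i) \<le> (\<Sum>j\<in>J. of_bool (B j i) :: real)"
        by (rule member_le_sum[OF j(1) _ fin]) auto
      then show ?thesis using j by simp
    qed (auto intro: sum_nonneg)
  qed
  with less show False by simp
qed

section \<open>Crossing, pigeonhole and Diophantine approximation\<close>

lemma sequence_crosses:
  assumes "F x \<in> T" "F y \<notin> T"
  shows "\<exists>i. (F i \<in> T) \<noteq> (F (Suc i) \<in> T)"
proof (rule ccontr)
  assume neg: "\<not> ?thesis"
  have "F i \<in> T \<longleftrightarrow> F 0 \<in> T" for i
    using neg by (induction i) auto
  with assms show False by blast
qed

text \<open>If every candidate failed at some scale, all of them would fail at the smallest of these
  scales.\<close>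

lemma finite_choice_at_all_scales:
  fixes Q :: "'b \<Rightarrow> real \<Rightarrow> bool"
  assumes fin: "finite A" and ex: "\<And>\<epsilon>. \<epsilon> > 0 \<Longrightarrow> \<exists>a\<in>A. Q a \<epsilon>"
    and mono: "\<And>a \<epsilon> \<epsilon>'. Q a \<epsilon> \<Longrightarrow> \<epsilon> \<le> \<epsilon>' \<Longrightarrow> Q a \<epsilon>'"
  shows "\<exists>a\<in>A. \<forall>\<epsilon>>0. Q a \<epsilon>"
proof (rule ccontr)
  assume "\<not> ?thesis"
  then obtain e where e: "\<And>a. a \<in> A \<Longrightarrow> e a > 0 \<and> \<not> Q a (e a)" by metis
  define \<epsilon> where "\<epsilon> = Min (insert 1 (e ` A))"
  have "\<epsilon> > 0" using fin e by (auto simp: \<epsilon>_def)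
  with ex obtain a where a: "a \<in> A" "Q a \<epsilon>" by blast
  moreover have "\<epsilon> \<le> e a" using fin a by (simp add: \<epsilon>_def)
  ultimately show False using mono e by blast
qed

text \<open>Kronecker's theorem gives an integer multiplier of unknown sign. Adding a large multiple
  of a Dirichlet denominator makes it positive at little cost in precision.\<close>

lemma frequencies_mod_1_dense:
  fixes f g :: real
  assumes indep: "\<And>c0 c1 c2 :: int. of_int c0 + of_int c1 * f + of_int c2 * g = 0
      \<Longrightarrow> c0 = 0 \<and> c1 = 0 \<and> c2 = 0"
    and "\<epsilon> > 0"
  obtains n :: nat and p q :: int where "n > 0"
    "\<bar>real n * f - of_int p - s\<bar> < \<epsilon>" "\<bar>real n * g - of_int q - t\<bar> < \<epsilon>"
proof -
  \<comment> \<open>Kronecker's theorem is applied with the constant 1 as last entry, at index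
    2.\<close>
  define \<theta> :: "nat \<Rightarrow> real" where "\<theta> = (\<lambda>i. if i = 0 then f else if i = 1 then g else 1)"
  have set: "{..2::nat} = {0, 1, 2}" by auto
  have ne: "f \<noteq> g" "f \<noteq> 1" "g \<noteq> 1"
    using indep[of 0 1 "-1"] indep[of "-1" 1 0] indep[of "-1" 0 1] by auto
  have im: "\<theta> ` {..2} = {f, g, 1}" unfolding set by (auto simp: \<theta>_def)
  interpret Modules.module "\<lambda>r x. real_of_int r * x"
    by (simp add: Modules.module.intro distrib_left mult.commute)
  have ind: "independent (\<theta> ` {..2})"
  proof
    assume "dependent (\<theta> ` {..2})"
    then obtain u where u: "\<exists>v\<in>{f,g,1}. u v \<noteq> 0" "(\<Sum>v\<in>{f,g,1}. of_int (u v) * v) = 0"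
      unfolding im by (subst (asm) dependent_finite) auto
    then have "of_int (u 1) + of_int (u f) * f + of_int (u g) * g = 0"
      using ne by simp
    from indep[OF this] u(1) show False by auto
  qed
  have inj: "inj_on \<theta> {..2}"
    unfolding set using ne by (auto simp: \<theta>_def inj_on_def)
  obtain K m where K: "\<And>i. i < 2 \<Longrightarrow> \<bar>of_int K * \<theta> i - of_int (m i) - (if i = 0 then s else t)\<bar> < \<epsilon> / 2"
    by (rule Kronecker_thm_2[OF ind inj _ half_gt_zero[OF \<open>\<epsilon> > 0\<close>],
          of "\<lambda>i. if i = 0 then s else t"]) (auto simp: \<theta>_def)
  \<comment> \<open>As \<open>q\<close> is at least 1, this makes \<open>K + q * M\<close> positive;
    \<open>N\<close> is then chosen so that \<open>M\<close> times the Dirichlet error stays below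
    \<open>\<epsilon> / 2\<close>.\<close>
  define M where "M = \<bar>K\<bar> + 1"
  obtain N :: nat where N: "N > 0" "1 / N < \<epsilon> / 2 / M"
    using real_arch_inverse[of "\<epsilon> / 2 / M"] \<open>\<epsilon> > 0\<close> by (auto simp: M_def inverse_eq_divide)
  obtain q p where q: "0 < q" "\<And>i. i < 2 \<Longrightarrow> \<bar>of_int q * \<theta> i - of_int (p i)\<bar> < 1 / N"
    using Dirichlet_approx_simult[OF N(1), of 2 \<theta>] by metis
  have "q * M \<ge> M" using q by (simp add: M_def)
  moreover have "K + M > 0" unfolding M_def by linarith
  ultimately have pos: "K + q * M > 0" by linarith
  have *: "\<bar>of_int (K + q * M) * \<theta> i - of_int (m i + M * p i) - (if i = 0 then s else t)\<bar> < \<epsilon>"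
    if "i < 2" for i
  proof -
    define x y where "x = of_int K * \<theta> i - of_int (m i) - (if i = 0 then s else t)"
      and "y = of_int q * \<theta> i - of_int (p i)"
    have "\<bar>y\<bar> < \<epsilon> / 2 / M" using q(2)[OF that] N unfolding y_def by linarith
    then have "\<bar>y\<bar> * M < \<epsilon> / 2" by (subst (asm) pos_less_divide_eq) (auto simp: M_def)
    then have "\<bar>M * y\<bar> < \<epsilon> / 2" by (simp add: abs_mult M_def mult.commute)
    moreover have "\<bar>x\<bar> < \<epsilon> / 2" using K[OF that] by (simp only: x_def)
    ultimately have "\<bar>x + M * y\<bar> < \<epsilon>" by linarith
    moreover have "x + M * y
        = of_int (K + q * M) * \<theta> i - of_int (m i + M * p i) - (if i = 0 then s else t)"
      unfolding x_def y_def of_int_add of_int_mult ring_distribs by (simp only: ac_simps)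
    ultimately show ?thesis by (simp only:)
  qed
  define n where "n = nat (K + q * M)"
  have n: "n > 0" "real_of_int (K + q * M) = real n" using pos by (auto simp: n_def)
  show thesis
  proof (rule that)
    show "\<bar>real n * f - of_int (m 0 + M * p 0) - s\<bar> < \<epsilon>"
      using *[of 0] unfolding n by (simp only: \<theta>_def) simp
    show "\<bar>real n * g - of_int (m 1 + M * p 1) - t\<bar> < \<epsilon>"
      using *[of 1] unfolding n by (simp only: \<theta>_def) simp
  qed (rule n)
qed

section \<open>Walks with few displacements\<close>

definition wedge :: "int \<times> int \<Rightarrow> int \<times> int \<Rightarrow> int" where
  "wedge a b = fst a * snd b - snd a * fst b"

lemma wedge_swap: "wedge b a = - wedge a b"
  by (simp add: wedge_def)

lemma wedge_self: "wedge a a = 0"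
  and wedge_zero_left: "wedge 0 b = 0"
  and wedge_add_left: "wedge (a + c) b = wedge a b + wedge c b"
  and wedge_minus_left: "wedge (- a) b = - wedge a b"
  and wedge_diff_left: "wedge (a - c) b = wedge a b - wedge c b"
  by (auto simp: wedge_def algebra_simps)

text \<open>The root system A2: the nonzero differences of the steps (0,0), (1,0), (0,1), that is,
  the six neighbours of the origin in the triangular lattice.\<close>

definition roots :: "(int \<times> int) set" where
  "roots = {(1, 0), (-1, 0), (0, 1), (0, -1), (1, -1), (-1, 1)}"

lemma uminus_roots: "a \<in> roots \<Longrightarrow> - a \<in> roots"
  by (auto simp: roots_def)

lemma wedge_roots: "a \<in> roots \<Longrightarrow> b \<in> roots \<Longrightarrow> wedge a b \<noteq> 0 \<Longrightarrow> \<bar>wedge a b\<bar> = 1"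
  by (auto simp: roots_def wedge_def)

text \<open>A counterexample in terms of the counts of two letters, the third count being determined
  by the length. The aim is to show that these assumptions are contradictory.\<close>

locale low_complexity_walk =
  fixes P :: "nat \<Rightarrow> int \<times> int" and f g :: real and k :: nat
  assumes k_pos: "k > 0"
    and limit_fst: "(\<lambda>n. real_of_int (fst (P n)) / real n) \<longlonglongrightarrow> f"
    and limit_snd: "(\<lambda>n. real_of_int (snd (P n)) / real n) \<longlonglongrightarrow> g"
    and step: "P (Suc n) - P n \<in> {(0, 0), (1, 0), (0, 1)}"
    and card_le_3: "n > 0 \<Longrightarrow> card (range (\<lambda>i. P (i + k * n) - P i)) \<le> 3"
    and indep: "of_int c0 + of_int c1 * f + of_int c2 * g = 0 \<Longrightarrow> c0 = 0 \<and> c1 = 0 \<and> c2 = 0"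
begin

section \<open>Displacements and their mean\<close>

definition D :: "nat \<Rightarrow> nat \<Rightarrow> int \<times> int" where
  "D m i = P (i + m) - P i"

lemma D_add: "D (m + n) i = D m i + D n (i + m)"
  by (simp add: D_def add.assoc)

text \<open>Sliding the window by one position gains one step and loses another, so the change is a
  difference of two steps.\<close>

lemma D_step: "D m (Suc i) = D m i \<or> D m (Suc i) - D m i \<in> roots"
proof -
  have "D m (Suc i) - D m i = (P (Suc (i + m)) - P (i + m)) - (P (Suc i) - P i)"
    by (simp add: D_def)
  with step[of "i + m"] step[of i] show ?thesis
    by (auto simp: roots_def simp flip: zero_prod_def)
qed

text \<open>This gives content to \<open>card_le_3\<close>, since \<open>card\<close> is 0 on
  infinite sets.\<close>

lemma finite_range_D: "finite (range (D m))"
proof -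
  have "0 \<le> fst (D m i) \<and> fst (D m i) \<le> m \<and> 0 \<le> snd (D m i) \<and> snd (D m i) \<le> m" for i
  proof (induction m)
    case (Suc m)
    define e where "e = P (Suc (i + m)) - P (i + m)"
    have "D (Suc m) i = D m i + e" by (simp add: D_def e_def)
    moreover have "fst e \<in> {0, 1}" "snd e \<in> {0, 1}"
      using step[of "i + m"] by (auto simp: e_def[symmetric])
    ultimately show ?case using Suc by auto
  qed (simp add: D_def)
  then have "range (D m) \<subseteq> {0..int m} \<times> {0..int m}" by (simp add: image_subset_iff mem_Times_iff)
  then show ?thesis by (rule finite_subset) simp
qed

lemma D_mean:
  "has_mean (\<lambda>i. of_int (c1 * fst (D m i) + c2 * snd (D m i) + c0))
     (real m * (of_int c1 * f + of_int c2 * g) + of_int c0)"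
proof -
  have "has_mean (\<lambda>i. of_int c1 * (real_of_int (fst (P (i + m))) - of_int (fst (P i))) +
      of_int c2 * (real_of_int (snd (P (i + m))) - of_int (snd (P i))) + of_int c0)
     (of_int c1 * (real m * f) + of_int c2 * (real m * g) + of_int c0)"
    by (intro has_mean_add has_mean_const has_mean_cmult has_mean_difference limit_fst limit_snd)
  then show ?thesis
    by (simp add: D_def algebra_simps)
qed

text \<open>A line with integer coefficients containing all displacements would contain their mean
  \<open>m (f, g)\<close>, contradicting \<open>indep\<close>.\<close>

lemma D_not_collinear:
  assumes "m > 0" "c1 \<noteq> 0 \<or> c2 \<noteq> 0"
  shows "\<exists>i. c1 * fst (D m i) + c2 * snd (D m i) \<noteq> c0"
proof (rule ccontr)
  assume "\<not> ?thesis"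
  then have "(\<lambda>i. real_of_int (c1 * fst (D m i) + c2 * snd (D m i) + (- c0))) = (\<lambda>_. 0)" by auto
  with D_mean[of c1 m c2 "- c0"] have "has_mean (\<lambda>_. 0) (real m * (of_int c1 * f + of_int c2 * g) - of_int c0)"
    by simp
  then have "of_int (- c0) + of_int (m * c1) * f + of_int (m * c2) * g = 0"
    using has_mean_unique[OF has_mean_const] by (fastforce simp: algebra_simps)
  from indep[OF this] assms show False by simp
qed

section \<open>Unimodular triangles and area coordinates\<close>

definition triangle :: "nat \<Rightarrow> int \<times> int \<Rightarrow> int \<times> int \<Rightarrow> int \<times> int \<Rightarrow> bool" where
  "triangle m p a b \<longleftrightarrow> m > 0 \<and> range (D m) = {p, p + a, p + b} \<and> \<bar>wedge a b\<bar> = 1"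

lemma triangle_swap: "triangle m p a b \<Longrightarrow> triangle m p b a"
  using wedge_swap[of a b] by (auto simp: triangle_def insert_commute)

lemma triangle_rotate: "triangle m p a b \<Longrightarrow> triangle m (p + a) (b - a) (- a)"
  by (auto simp: triangle_def wedge_def insert_commute algebra_simps)

text \<open>The area coordinate of \<open>m (f, g)\<close> with respect to the vertex \<open>p + a\<close>.\<close>

definition weight :: "nat \<Rightarrow> int \<times> int \<Rightarrow> int \<times> int \<Rightarrow> int \<times> int \<Rightarrow> real" where
  "weight m p a b = of_int (wedge a b) *
     ((real m * f - of_int (fst p)) * of_int (snd b) - (real m * g - of_int (snd p)) * of_int (fst b))"

text \<open>On the three vertices the affine functional defining the weight is the indicator of
  \<open>p + a\<close>, and taking means commutes with affine functionals.\<close>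

lemma weight_has_mean:
  assumes "triangle m p a b"
  shows "has_mean (\<lambda>i. of_bool (D m i = p + a)) (weight m p a b)"
proof -
  have ind: "of_bool (D m i = p + a) = wedge a b * wedge (D m i - p) b" for i
  proof -
    have "D m i \<in> {p, p + a, p + b}" using assms by (auto simp: triangle_def)
    moreover have "wedge a b * wedge a b = 1" using assms
      by (auto simp: triangle_def abs_if split: if_splits)
    moreover have "a \<noteq> 0" "a \<noteq> b" using assms by (auto simp: triangle_def wedge_def)
    moreover have "wedge 0 b = 0" "wedge b b = 0" by (auto simp: wedge_def)
    ultimately show ?thesis by auto
  qed
  have eq: "real_of_int (wedge a b * wedge (D m i - p) b) =
      of_int (wedge a b * snd b * fst (D m i) + (- wedge a b * fst b) * snd (D m i)
        + (wedge a b * (snd p * fst b - fst p * snd b)))" for i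
    by (simp add: wedge_def algebra_simps)
  have "has_mean (\<lambda>i. of_int (of_bool (D m i = p + a))) (weight m p a b)"
    unfolding ind eq weight_def using D_mean[of "wedge a b * snd b" m "- wedge a b * fst b" "wedge a b * (snd p * fst b - fst p * snd b)"]
    by (simp add: algebra_simps)
  then show ?thesis by (simp add: of_bool_def if_distrib cong: if_cong)
qed

text \<open>A density is nonnegative; if it were 0, \<open>m (f, g)\<close> would lie on the
  rational line through \<open>p\<close> and \<open>p + b\<close>.\<close>

lemma weight_pos:
  assumes "triangle m p a b"
  shows "weight m p a b > 0"
proof -
  have "0 \<le> weight m p a b"
    by (rule has_mean_mono[OF has_mean_const weight_has_mean[OF assms]]) simp
  moreover have "weight m p a b \<noteq> 0"
  proof
    assume "weight m p a b = 0"
    then have "(real m * f - of_int (fst p)) * of_int (snd b) - (real m * g - of_int (snd p)) * of_int (fst b) = 0"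
      using assms by (auto simp: weight_def triangle_def)
    then have "of_int (snd p * fst b - fst p * snd b) + of_int (int m * snd b) * f
        + of_int (- int m * fst b) * g = 0"
      by (simp add: algebra_simps)
    from indep[OF this] assms show False by (auto simp: triangle_def wedge_def)
  qed
  ultimately show ?thesis by simp
qed

text \<open>The left-hand side is the area coordinate of \<open>p\<close>, seen from
  \<open>p + a\<close>; the three coordinates sum to 1.\<close>

lemma weight_rotate:
  assumes "triangle m p a b"
  shows "weight m (p + a) (- a) (b - a) = 1 - weight m p a b - weight m p b a"
proof -
  define \<delta> where "\<delta> = wedge a b"
  have \<delta>: "wedge b a = - \<delta>" "wedge (-a) (b - a) = - \<delta>" by (auto simp: \<delta>_def wedge_def algebra_simps)
  have "real_of_int \<delta> * \<delta> = 1"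
    using assms by (auto simp: triangle_def \<delta>_def abs_if split: if_splits)
  then have "real_of_int \<delta> * (fst a * snd b - snd a * fst b) = 1"
    by (simp add: \<delta>_def wedge_def)
  then show ?thesis
    unfolding weight_def \<delta>_def[symmetric] \<delta> by (simp add: algebra_simps)
qed

lemma weight_sum_less_1:
  assumes "triangle m p a b"
  shows "weight m p a b + weight m p b a < 1"
  using weight_pos[OF triangle_swap[OF triangle_rotate[OF assms]]] weight_rotate[OF assms] by simp

text \<open>Cramer's rule, with a determinant whose square is 1.\<close>

lemma coordinates:
  assumes "triangle m p a b"
  shows "real m * f - of_int (fst p) = weight m p a b * of_int (fst a) + weight m p b a * of_int (fst b)"
    and "real m * g - of_int (snd p) = weight m p a b * of_int (snd a) + weight m p b a * of_int (snd b)"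
proof -
  define \<delta> where "\<delta> = wedge a b"
  have \<delta>: "wedge b a = - \<delta>" by (auto simp: \<delta>_def wedge_def)
  have 1: "real_of_int \<delta> * \<delta> = 1"
    using assms by (auto simp: triangle_def \<delta>_def abs_if split: if_splits)
  have 2: "real_of_int \<delta> = fst a * snd b - snd a * fst b" by (simp add: \<delta>_def wedge_def)
  have "weight m p a b * of_int (fst a) + weight m p b a * of_int (fst b)
      = real_of_int \<delta> * (fst a * snd b - snd a * fst b) * (real m * f - of_int (fst p))"
    unfolding weight_def \<delta>_def[symmetric] \<delta> by (simp add: algebra_simps)
  then show "real m * f - of_int (fst p) = weight m p a b * of_int (fst a) + weight m p b a * of_int (fst b)"
    using 1 2 by simp
  have "weight m p a b * of_int (snd a) + weight m p b a * of_int (snd b)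
      = real_of_int \<delta> * (fst a * snd b - snd a * fst b) * (real m * g - of_int (snd p))"
    unfolding weight_def \<delta>_def[symmetric] \<delta> by (simp add: algebra_simps)
  then show "real m * g - of_int (snd p) = weight m p a b * of_int (snd a) + weight m p b a * of_int (snd b)"
    using 1 2 by simp
qed

text \<open>The values are connected through root differences, not collinear, and at most three in
  number. Hence they form a path of two roots; based at its middle point, the triangle has two root
  edges, whose nonzero determinant must be 1 or -1.\<close>

lemma root_triangle:
  assumes "k dvd m" "m > 0"
  obtains s a b where "triangle m s a b" "a \<in> roots" "b \<in> roots"
proof -
  obtain n where n: "m = k * n" "n > 0" using assms by fastforce
  have card: "card (range (D m)) \<le> 3"
    using card_le_3[OF n(2)] unfolding D_def n by simp
  have neighbour: "\<exists>y \<in> T. \<exists>z \<in> range (D m) - T. z - y \<in> roots"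
    if "x \<in> range (D m)" "x \<in> T" "y \<in> range (D m)" "y \<notin> T" for x y T
  proof -
    from that obtain i0 i1 where "D m i0 \<in> T" "D m i1 \<notin> T" by blast
    from sequence_crosses[OF this] obtain i where i: "(D m i \<in> T) \<noteq> (D m (Suc i) \<in> T)" ..
    with D_step[of m i] have "D m (Suc i) - D m i \<in> roots" by auto
    moreover from uminus_roots[OF this] have "D m i - D m (Suc i) \<in> roots" by simp
    ultimately show ?thesis using i by blast
  qed
  define u where "u = D m 0"
  have "\<exists>i. 1 * fst (D m i) + 0 * snd (D m i) \<noteq> fst u"
    by (rule D_not_collinear) (use assms in auto)
  then obtain i where "D m i \<noteq> u" by fastforce
  with neighbour[of u "{u}" "D m i"] obtain v where v: "v \<in> range (D m)" "v \<noteq> u" "v - u \<in> roots"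
    by (auto simp: u_def)
  have nz: "snd (v - u) \<noteq> 0 \<or> - fst (v - u) \<noteq> 0" using v(2) by (auto simp: prod_eq_iff)
  obtain j where j: "snd (v - u) * fst (D m j) + (- fst (v - u)) * snd (D m j)
      \<noteq> snd (v - u) * fst u - fst (v - u) * snd u"
    using D_not_collinear[OF assms(2) nz] by blast
  define w where "w = D m j"
  have wedge_ne: "wedge (v - u) (w - u) \<noteq> 0"
    using j by (auto simp: wedge_def w_def algebra_simps)
  then have ne: "w \<noteq> u" "w \<noteq> v" by (auto simp: wedge_def)
  have "{u, v, w} = range (D m)"
    using card v ne by (intro card_seteq finite_range_D) (auto simp: u_def w_def)
  then have range: "range (D m) = {u, v, w}" by simp
  from neighbour[of w "{w}" u] ne obtain z where z: "z \<in> {u, v}" "z - w \<in> roots"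
    unfolding range by auto
  then have "w - z \<in> roots" using uminus_roots[of "z - w"] by simp
  show thesis
  proof (cases "z = u")
    case True
    have "triangle m u (v - u) (w - u)"
      using wedge_roots[OF v(3) _ wedge_ne] \<open>w - z \<in> roots\<close> True range assms
      by (auto simp: triangle_def)
    then show thesis using that v(3) \<open>w - z \<in> roots\<close> True by blast
  next
    case False
    then have z: "z = v" using z by simp
    have uv: "u - v \<in> roots" using uminus_roots[OF v(3)] by simp
    have "wedge (u - v) (w - v) \<noteq> 0" using wedge_ne by (auto simp: wedge_def algebra_simps)
    then have "triangle m v (u - v) (w - v)"
      using wedge_roots[OF uv, of "w - v"] \<open>w - z \<in> roots\<close> z range assms
      by (auto simp: triangle_def insert_commute)
    then show thesis using that uv \<open>w - z \<in> roots\<close> z by blast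
  qed
qed

text \<open>In each coordinate the mean, lying inside a triangle with root edges, is within 1 of the
  base vertex, and so is every vertex.\<close>

lemma D_near_mean:
  assumes "k dvd m" "m > 0" "q \<in> range (D m)"
  shows "\<bar>real m * f - of_int (fst q)\<bar> \<le> 2" "\<bar>real m * g - of_int (snd q)\<bar> \<le> 2"
proof -
  obtain s a b where t: "triangle m s a b" "a \<in> roots" "b \<in> roots"
    using root_triangle[OF assms(1,2)] .
  define \<alpha> \<beta> where "\<alpha> = weight m s a b" and "\<beta> = weight m s b a"
  have pos: "\<alpha> > 0" "\<beta> > 0" "\<alpha> + \<beta> < 1"
    using weight_pos[OF t(1)] weight_pos[OF triangle_swap[OF t(1)]] weight_sum_less_1[OF t(1)]
    by (auto simp: \<alpha>_def \<beta>_def)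
  have *: "\<bar>\<alpha> * of_int x + \<beta> * of_int y\<bar> \<le> 1" if "x \<in> {-1, 0, 1}" "y \<in> {-1, 0, 1}" for x y :: int
    using that pos by auto
  have f: "\<bar>real m * f - of_int (fst s)\<bar> \<le> 1" and g: "\<bar>real m * g - of_int (snd s)\<bar> \<le> 1"
    unfolding coordinates[OF t(1)] \<alpha>_def[symmetric] \<beta>_def[symmetric]
    using t by (auto intro!: * simp: roots_def)
  have "q \<in> {s, s + a, s + b}" using assms(3) t(1) by (auto simp: triangle_def)
  then have "\<bar>fst q - fst s\<bar> \<le> 1" "\<bar>snd q - snd s\<bar> \<le> 1"
    using t(2,3) by (auto simp: roots_def)
  then have "\<bar>real_of_int (fst q) - fst s\<bar> \<le> 1" "\<bar>real_of_int (snd q) - snd s\<bar> \<le> 1"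
    by linarith+
  with f g show "\<bar>real m * f - of_int (fst q)\<bar> \<le> 2" "\<bar>real m * g - of_int (snd q)\<bar> \<le> 2"
    by linarith+
qed

section \<open>Triangles at lattice points close to the mean\<close>

definition near :: "nat \<Rightarrow> int \<times> int \<Rightarrow> real \<Rightarrow> real \<Rightarrow> real \<Rightarrow> bool" where
  "near m p x y \<epsilon> \<longleftrightarrow>
     \<bar>real m * f - of_int (fst p) - x\<bar> < \<epsilon> \<and> \<bar>real m * g - of_int (snd p) - y\<bar> < \<epsilon>"

text \<open>The bound 2 allows for differences of roots, which become edges when a root triangle is
  based at another vertex.\<close>

definition short :: "(int \<times> int) set" where
  "short = {-2..2} \<times> {-2..2}"

lemma short_iff: "a \<in> short \<longleftrightarrow> \<bar>fst a\<bar> \<le> 2 \<and> \<bar>snd a\<bar> \<le> 2"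
  by (auto simp: short_def mem_Times_iff)

lemma finite_short: "finite short"
  by (simp add: short_def)

lemma root_short:
  assumes "a \<in> roots"
  shows "a \<in> short" "- a \<in> short" "b \<in> roots \<Longrightarrow> a - b \<in> short"
proof -
  have *: "\<bar>fst c\<bar> \<le> 1 \<and> \<bar>snd c\<bar> \<le> 1" if "c \<in> roots" for c
    using that by (auto simp: roots_def)
  from *[OF assms] *[of b] show "a \<in> short" "- a \<in> short" "b \<in> roots \<Longrightarrow> a - b \<in> short"
    unfolding short_iff fst_diff snd_diff fst_uminus snd_uminus by linarith+
qed

lemma cross_bound:
  fixes x y \<epsilon> :: real and c d :: int
  assumes "\<bar>x\<bar> < \<epsilon>" "\<bar>y\<bar> < \<epsilon>" "\<bar>c\<bar> \<le> n" "\<bar>d\<bar> \<le> n" "n > 0"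
  shows "\<bar>x * of_int c - y * of_int d\<bar> < 2 * n * \<epsilon>"
proof -
  have "\<bar>x * of_int c\<bar> \<le> \<bar>x\<bar> * n" "\<bar>y * of_int d\<bar> \<le> \<bar>y\<bar> * n"
    using assms by (auto simp: abs_mult intro!: mult_left_mono)
  moreover have "\<bar>x\<bar> * n < \<epsilon> * n" "\<bar>y\<bar> * n < \<epsilon> * n" using assms by auto
  moreover have "2 * n * \<epsilon> = \<epsilon> * n + \<epsilon> * n" by simp
  ultimately show ?thesis by linarith
qed

text \<open>The coordinates of \<open>p\<close> in a root triangle are integers, each within 1/4 of
  an area coordinate of \<open>m (f, g)\<close>. The latter are positive with sum below 1, so only
  the three vertices are possible for \<open>p\<close>.\<close>

lemma near_triangle:
  assumes "k dvd m" "m > 0" "near m p 0 0 (1/8)"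
  obtains a b where "triangle m p a b" "a \<in> short" "b \<in> short"
proof -
  obtain s a b where t: "triangle m s a b" "a \<in> roots" "b \<in> roots"
    using root_triangle[OF assms(1,2)] .
  have coord: "\<bar>wedge a b * wedge (p - s) b - weight m s a b\<bar> < 1/4"
    if "triangle m s a b" "b \<in> roots" for a b
  proof -
    have "of_int (wedge a b * wedge (p - s) b) - weight m s a b =
       of_int (- wedge a b) * ((real m * f - of_int (fst p)) * of_int (snd b) - (real m * g - of_int (snd p)) * of_int (fst b))"
      unfolding weight_def wedge_def[of "p - s"] by (simp add: algebra_simps)
    moreover have "\<bar>real_of_int (- wedge a b)\<bar> = 1"
      using that(1) by (auto simp: triangle_def abs_if split: if_splits)
    moreover have "\<bar>snd b\<bar> \<le> 1" "\<bar>fst b\<bar> \<le> 1" using that(2) by (auto simp: roots_def)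
    ultimately show ?thesis
      using cross_bound[of "real m * f - of_int (fst p)" "1/8" "real m * g - of_int (snd p)" "snd b" 1 "fst b"] assms(3)
      by (simp only: abs_mult) (simp add: near_def)
  qed
  define x y where "x = wedge a b * wedge (p - s) b" and "y = wedge b a * wedge (p - s) a"
  have "wedge a b * wedge a b = 1" using t by (auto simp: triangle_def abs_if split: if_splits)
  then have 1: "wedge a b * (fst a * snd b - snd a * fst b) = 1" by (simp add: wedge_def)
  have "fst (p - s) * (wedge a b * (fst a * snd b - snd a * fst b)) = x * fst a + y * fst b"
    "snd (p - s) * (wedge a b * (fst a * snd b - snd a * fst b)) = x * snd a + y * snd b"
    unfolding x_def y_def wedge_swap[of a b] wedge_def[of "p - s"] by (simp_all add: algebra_simps)
  then have p: "fst p = fst s + (x * fst a + y * fst b)" "snd p = snd s + (x * snd a + y * snd b)"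
    unfolding 1 by simp_all
  have "\<bar>x - weight m s a b\<bar> < 1/4" "\<bar>y - weight m s b a\<bar> < 1/4"
    using coord[OF t(1,3)] coord[OF triangle_swap[OF t(1)] t(2)] by (simp_all add: x_def y_def)
  moreover have "weight m s a b > 0" "weight m s b a > 0" "weight m s a b + weight m s b a < 1"
    using weight_pos[OF t(1)] weight_pos[OF triangle_swap[OF t(1)]] weight_sum_less_1[OF t(1)] by auto
  ultimately have "real_of_int x > -1" "real_of_int y > -1" "real_of_int (x + y) < 2"
    by (auto simp: abs_if split: if_splits)
  then have "x \<ge> 0" "y \<ge> 0" "x + y \<le> 1" by linarith+
  then consider "x = 0" "y = 0" | "x = 1" "y = 0" | "x = 0" "y = 1" by linarith
  then show thesis
  proof cases
    case 1
    then have "p = s" using p by (simp add: prod_eq_iff)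
    with t show thesis
      using root_short(1) by (intro that[of a b]) auto
  next
    case 2
    then have "p = s + a" using p by (simp add: prod_eq_iff)
    with triangle_rotate[OF t(1)] t show thesis
      using root_short by (intro that[of "b - a" "- a"]) auto
  next
    case 3
    then have "p = s + b" using p by (simp add: prod_eq_iff)
    with triangle_rotate[OF triangle_swap[OF t(1)]] t show thesis
      using root_short by (intro that[of "a - b" "- b"]) auto
  qed
qed

text \<open>The weight is linear in the offset \<open>m (f, g) - p\<close>, with coefficients of
  size at most 2.\<close>

lemma weight_near:
  assumes "triangle m p a b" "near m p x y \<epsilon>" "b \<in> short"
  shows "\<bar>weight m p a b - of_int (wedge a b) * (x * of_int (snd b) - y * of_int (fst b))\<bar> < 4 * \<epsilon>"
proof -
  have "weight m p a b - of_int (wedge a b) * (x * of_int (snd b) - y * of_int (fst b)) =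
      of_int (wedge a b) * ((real m * f - of_int (fst p) - x) * of_int (snd b)
        - (real m * g - of_int (snd p) - y) * of_int (fst b))"
    by (simp add: weight_def algebra_simps)
  moreover have "\<bar>real_of_int (wedge a b)\<bar> = 1"
    using assms(1) by (auto simp: triangle_def abs_if split: if_splits)
  ultimately show ?thesis
    using cross_bound[of "real m * f - of_int (fst p) - x" \<epsilon> "real m * g - of_int (snd p) - y" "snd b" 2 "fst b"] assms(2,3)
    by (simp only: abs_mult) (simp add: near_def short_iff)
qed

text \<open>Approximating with \<open>k * f\<close> and \<open>k * g\<close>, which are still
  independent of 1, makes \<open>m\<close> a multiple of \<open>k\<close>.\<close>

lemma near_ex:
  assumes "\<epsilon> > 0"
  obtains m p where "k dvd m" "m > 0" "near m p x y \<epsilon>"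
proof -
  have "c0 = 0 \<and> c1 = 0 \<and> c2 = 0"
    if "of_int c0 + of_int c1 * (real k * f) + of_int c2 * (real k * g) = 0" for c0 c1 c2 :: int
    using indep[of c0 "c1 * int k" "c2 * int k"] that k_pos by (simp add: algebra_simps)
  then obtain n p q where "n > 0" "\<bar>real n * (real k * f) - of_int p - x\<bar> < \<epsilon>"
    "\<bar>real n * (real k * g) - of_int q - y\<bar> < \<epsilon>"
    using frequencies_mod_1_dense[OF _ assms, of "real k * f" "real k * g" x y] by metis
  then show thesis
    using that[of "k * n" "(p, q)"] k_pos by (simp add: near_def algebra_simps)
qed

section \<open>Adding displacements of different scales\<close>

lemma ex_value:
  assumes t: "triangle m p a b" and A: "has_mean (\<lambda>i. of_bool (A i)) x"
    and less: "weight m p a b + weight m p b a < x"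
  obtains i where "A i" "D m i = p"
proof -
  have "a \<noteq> b" using t by (auto simp: triangle_def wedge_def)
  have "\<exists>i. A i \<and> (\<forall>c\<in>{a, b}. \<not> D m i = p + c)"
  proof (rule has_mean_ex[OF A])
    show "has_mean (\<lambda>i. of_bool (D m i = p + c)) (if c = a then weight m p a b else weight m p b a)"
      if "c \<in> {a, b}" for c
      using that weight_has_mean[OF t] weight_has_mean[OF triangle_swap[OF t]] by auto
  qed (use less \<open>a \<noteq> b\<close> in auto)
  then obtain i where "A i" "D m i \<noteq> p + a" "D m i \<noteq> p + b" by blast
  moreover have "D m i \<in> {p, p + a, p + b}" using t by (auto simp: triangle_def)
  ultimately show thesis using that by blast
qed

text \<open>\<open>D m\<close> differs from \<open>p\<close> so rarely that \<open>p\<close> meets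
  an occurrence of each vertex of the other triangle. The resulting three sums already exhaust the
  permitted number of values.\<close>

lemma triangle_add:
  assumes k: "k dvd m" "k dvd m'" and t: "triangle m p a b" and t': "triangle m' p' a' b'"
    and small: "weight m p a b + weight m p b a < weight m' p' a' b'"
      "weight m p a b + weight m p b a < weight m' p' b' a'"
      "weight m p a b + weight m p b a + weight m' p' a' b' + weight m' p' b' a' < 1"
  shows "range (D (m + m')) = {p + p', p + p' + a', p + p' + b'}"
proof -
  have ne: "a' \<noteq> 0" "b' \<noteq> 0" "a' \<noteq> b'" using t' by (auto simp: triangle_def wedge_def)
  have mem: "p + p' + c \<in> range (D (m + m'))"
    if A: "has_mean (\<lambda>i. of_bool (D m' i = p' + c)) x"
      and less: "weight m p a b + weight m p b a < x" for c x
  proof -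
    obtain i where "D m' (i + m) = p' + c" "D m i = p"
      using ex_value[OF t has_mean_shift[OF A] less] by blast
    then have "D (m + m') i = p + p' + c" by (simp add: D_add add.assoc)
    then show ?thesis by (metis rangeI)
  qed
  \<comment> \<open>Seen from \<open>p' + a'\<close> the edge \<open>- a'\<close> leads to
    \<open>p'\<close>, so this triangle supplies the density of \<open>p'\<close>.\<close>
  have t0: "triangle m' (p' + a') (- a') (b' - a')"
    by (rule triangle_swap[OF triangle_rotate[OF t']])
  have "p + p' \<in> range (D (m + m'))"
    using mem[of 0] weight_has_mean[OF t0] small(3) unfolding weight_rotate[OF t'] by simp
  moreover have "p + p' + a' \<in> range (D (m + m'))" "p + p' + b' \<in> range (D (m + m'))"
    using mem weight_has_mean[OF t'] weight_has_mean[OF triangle_swap[OF t']] small by auto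
  moreover have "card (range (D (m + m'))) \<le> 3"
  proof -
    have "k dvd m + m'" "m + m' > 0" using k t by (auto simp: triangle_def)
    then obtain n where "m + m' = k * n" "n > 0" by fastforce
    then show ?thesis using card_le_3[of n] by (simp add: D_def)
  qed
  ultimately have "{p + p', p + p' + a', p + p' + b'} = range (D (m + m'))"
    using ne by (intro card_seteq finite_range_D) auto
  then show ?thesis by simp
qed

text \<open>Wherever \<open>D m\<close> takes the value \<open>p + a\<close>, adding the following
  value of \<open>D m'\<close> must again give a vertex of the translated triangle.\<close>

lemma triangle_add_differences:
  assumes k: "k dvd m" "k dvd m'" and t: "triangle m p a b" and t': "triangle m' p' a' b'"
    and small: "weight m p a b + weight m p b a < weight m' p' a' b'"
      "weight m p a b + weight m p b a < weight m' p' b' a'"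
      "weight m p a b + weight m p b a + weight m' p' a' b' + weight m' p' b' a' < 1"
  shows "a \<in> {a', b', - a', - b', a' - b', b' - a'}"
proof -
  have "a \<noteq> 0" using t by (auto simp: triangle_def wedge_def)
  have "p + a \<in> range (D m)" using t by (simp add: triangle_def)
  then obtain i where i: "p + a = D m i" by (rule rangeE)
  have "D m' (i + m) \<in> {p', p' + a', p' + b'}" using t' by (auto simp: triangle_def)
  then have "\<exists>c\<in>{0, a', b'}. D m' (i + m) = p' + c" by auto
  then obtain c where c: "c \<in> {0, a', b'}" "D m' (i + m) = p' + c" by blast
  then have "p + p' + (a + c) = D (m + m') i" by (simp add: D_add i[symmetric] algebra_simps)
  also have "\<dots> \<in> {p + p', p + p' + a', p + p' + b'}"
    using triangle_add[OF assms] by auto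
  finally have "a + c \<in> {0, a', b'}" by (simp add: add.assoc)
  moreover have "a = (a + c) - c" by simp
  ultimately show ?thesis using c \<open>a \<noteq> 0\<close> by (metis diff_0 diff_0_right diff_self insertE insertI1 insertI2 empty_iff)
qed

section \<open>Edges common to all scales\<close>

lemma near_mono: "near m p x y \<epsilon> \<Longrightarrow> \<epsilon> \<le> \<epsilon>' \<Longrightarrow> near m p x y \<epsilon>'"
  by (auto simp: near_def)

lemma near_scaled:
  assumes "near m p (t * of_int (fst a)) (t * of_int (snd a)) (\<epsilon> * t)" "a \<in> short" "t > 0" "\<epsilon> \<le> 1"
  shows "near m p 0 0 (3 * t)"
proof -
  have "\<bar>t * real_of_int (fst a)\<bar> \<le> t * 2" "\<bar>t * real_of_int (snd a)\<bar> \<le> t * 2"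
    using assms(2,3) by (auto simp: abs_mult short_iff intro!: mult_left_mono)
  moreover have "\<epsilon> * t \<le> 1 * t" using assms(3,4) by (intro mult_right_mono) auto
  ultimately show ?thesis using assms(1) unfolding near_def by linarith
qed

lemma weight_near_0:
  "triangle m p a b \<Longrightarrow> near m p 0 0 \<epsilon> \<Longrightarrow> b \<in> short \<Longrightarrow> weight m p a b < 4 * \<epsilon>"
  using weight_near[of m p a b 0 0 \<epsilon>] by simp

text \<open>Only finitely many edges are short, so one of them recurs as the scale shrinks.\<close>

lemma vertex_at_all_scales:
  "\<exists>a\<in>short. \<forall>\<epsilon>>0. \<exists>m p b. k dvd m \<and> triangle m p a b \<and> b \<in> short \<and> near m p 0 0 \<epsilon>"
proof (rule finite_choice_at_all_scales[OF finite_short])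
  fix \<epsilon> :: real assume "\<epsilon> > 0"
  obtain m p where m: "k dvd m" "m > 0" "near m p 0 0 (min \<epsilon> (1/8))"
    using near_ex[of "min \<epsilon> (1/8)" 0 0] \<open>\<epsilon> > 0\<close> by auto
  then have "near m p 0 0 (1/8)" "near m p 0 0 \<epsilon>" by (auto simp: near_def)
  moreover from near_triangle[OF m(1,2) this(1)]
  obtain a b where "triangle m p a b" "a \<in> short" "b \<in> short" .
  ultimately show "\<exists>a\<in>short. \<exists>m p b. k dvd m \<and> triangle m p a b \<and> b \<in> short \<and> near m p 0 0 \<epsilon>"
    using m(1) by blast
next
  fix a \<epsilon> \<epsilon>'
  assume "\<exists>m p b. k dvd m \<and> triangle m p a b \<and> b \<in> short \<and> near m p 0 0 \<epsilon>" "\<epsilon> \<le> \<epsilon>'"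
  then obtain m p b where "k dvd m" "triangle m p a b" "b \<in> short" "near m p 0 0 \<epsilon>'"
    by (elim exE conjE) (drule (1) near_mono, blast)
  then show "\<exists>m p b. k dvd m \<and> triangle m p a b \<and> b \<in> short \<and> near m p 0 0 \<epsilon>'" by blast
qed

text \<open>The error is relative to \<open>t\<close>, so \<open>m (f, g) - p\<close> points almost
  along \<open>a\<close>, and for short \<open>a\<close> the weight of \<open>p + b\<close> is only
  of order \<open>\<epsilon> * t\<close>.\<close>

definition aligned :: "int \<times> int \<Rightarrow> int \<times> int \<Rightarrow> real \<Rightarrow> nat \<Rightarrow> int \<times> int \<Rightarrow> real \<Rightarrow> bool" where
  "aligned a b \<epsilon> m p t \<longleftrightarrow> k dvd m \<and> triangle m p a b \<and> 0 < t \<and> t < \<epsilon> \<and>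
     near m p (t * of_int (fst a)) (t * of_int (snd a)) (\<epsilon> * t)"

lemma aligned_mono:
  assumes "aligned a b \<epsilon> m p t" "\<epsilon> \<le> \<epsilon>'"
  shows "aligned a b \<epsilon>' m p t"
proof -
  have "\<epsilon> * t \<le> \<epsilon>' * t"
    using assms by (intro mult_right_mono) (auto simp: aligned_def)
  then show ?thesis using assms near_mono unfolding aligned_def by (meson order_less_le_trans)
qed

text \<open>Choose \<open>m (f, g) - p\<close> almost equal to \<open>t * a\<close>. Comparison with
  a much smaller displacement having the edge \<open>a\<close> shows that \<open>a\<close> is a
  difference of vertices at \<open>m\<close>. Its direction points from \<open>p\<close> into the
  triangle, so it is an edge at \<open>p\<close>; a second pigeonhole fixes the other edge.\<close>

lemma aligned_triangle:
  "\<exists>a\<in>short. \<exists>b\<in>short. \<forall>\<epsilon>>0. \<exists>m p t. aligned a b \<epsilon> m p t"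
proof -
  obtain a where a: "a \<in> short" and small:
    "\<And>\<epsilon>. \<epsilon> > 0 \<Longrightarrow> \<exists>m p b. k dvd m \<and> triangle m p a b \<and> b \<in> short \<and> near m p 0 0 \<epsilon>"
    using vertex_at_all_scales by blast
  have "\<exists>b\<in>short. \<exists>m p t. aligned a b \<epsilon> m p t" if "\<epsilon> > 0" for \<epsilon>
  proof -
    \<comment> \<open>With these constants \<open>4 * \<epsilon>' \<le> 1\<close>,
      \<open>3 * t < 1/8\<close> and \<open>12 * t < 1/16\<close>.\<close>
    define \<epsilon>' where "\<epsilon>' = min \<epsilon> (1/100)"
    define t where "t = \<epsilon>' / 2"
    have \<epsilon>': "0 < \<epsilon>'" "\<epsilon>' \<le> \<epsilon>" "\<epsilon>' \<le> 1/100" "0 < t" "t < \<epsilon>" "t \<le> 1/200"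
      using \<open>\<epsilon> > 0\<close> by (auto simp: \<epsilon>'_def t_def)
    have "\<epsilon>' * t > 0" using \<epsilon>' by simp
    then obtain m p where m: "k dvd m" "m > 0"
      and near: "near m p (t * of_int (fst a)) (t * of_int (snd a)) (\<epsilon>' * t)"
      by (rule near_ex)
    have near\<epsilon>: "near m p (t * of_int (fst a)) (t * of_int (snd a)) (\<epsilon> * t)"
      using near_mono[OF near] \<epsilon>' by (simp add: mult_right_mono)
    have near0: "near m p 0 0 (3 * t)"
      using near_scaled[OF near a] \<epsilon>' by simp
    then have "near m p 0 0 (1/8)" using \<epsilon>' unfolding near_def by linarith
    then obtain a' b' where t': "triangle m p a' b'" and sh: "a' \<in> short" "b' \<in> short"
      using near_triangle[OF m] by blast
    note t'' = triangle_swap[OF t']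
    have w: "weight m p a' b' > 0" "weight m p b' a' > 0" "weight m p a' b' < 1/16" "weight m p b' a' < 1/16"
      using weight_pos[OF t'] weight_pos[OF t''] weight_near_0[OF t' near0 sh(2)]
        weight_near_0[OF t'' near0 sh(1)] \<epsilon>'(6) by linarith+
    \<comment> \<open>The two weights of \<open>m2\<close> will be below \<open>4 * \<eta>\<close>
      each, hence together below either weight of \<open>m\<close>.\<close>
    define \<eta> where "\<eta> = min (weight m p a' b') (weight m p b' a') / 8"
    have \<eta>: "8 * \<eta> \<le> weight m p a' b'" "8 * \<eta> \<le> weight m p b' a'" by (simp_all add: \<eta>_def)
    have "\<eta> > 0" using w by (simp add: \<eta>_def)
    then obtain m2 p2 b2 where m2: "k dvd m2" "triangle m2 p2 a b2" "b2 \<in> short" "near m2 p2 0 0 \<eta>"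
      using small by blast
    have w2: "weight m2 p2 a b2 < 4 * \<eta>" "weight m2 p2 b2 a < 4 * \<eta>"
      using weight_near_0[OF m2(2,4,3)] weight_near_0[OF triangle_swap[OF m2(2)] m2(4) a] .
    have "a \<in> {a', b', - a', - b', a' - b', b' - a'}"
      by (rule triangle_add_differences[OF m2(1) m(1) m2(2) t']) (use w w2 \<eta> in linarith)+
    \<comment> \<open>\<open>wedge c d * wedge a d\<close> is the coefficient of \<open>c\<close> in
      \<open>a\<close>. The positive weight of \<open>p + c\<close> is within \<open>t\<close> of
      \<open>t\<close> times this integer, which therefore exceeds -1.\<close>
    moreover have sgn: "wedge c d * wedge a d \<ge> 0" if td: "triangle m p c d" and "d \<in> short" for c d
    proof -
      have "of_int (wedge c d) * (t * of_int (fst a) * of_int (snd d) - t * of_int (snd a) * of_int (fst d))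
          = t * of_int (wedge c d * wedge a d)"
        unfolding wedge_def[of a d] by (simp add: algebra_simps)
      then have "\<bar>weight m p c d - t * of_int (wedge c d * wedge a d)\<bar> < 4 * (\<epsilon>' * t)"
        using weight_near[OF td near \<open>d \<in> short\<close>] by (simp only:)
      moreover have "4 * (\<epsilon>' * t) \<le> t"
        using mult_right_mono[of "4 * \<epsilon>'" 1 t] \<epsilon>' by simp
      ultimately have "t * of_int (wedge c d * wedge a d) > t * - 1"
        using weight_pos[OF td] by linarith
      then have "real_of_int (wedge c d * wedge a d) > - 1"
        using \<epsilon>' by (simp only: mult_less_cancel_left_pos)
      then show ?thesis by linarith
    qed
    have 1: "wedge a' b' * wedge a' b' = 1"
      using t' by (metis triangle_def abs_mult_self_eq mult_1)
    \<comment> \<open>Each of the four excluded differences has coefficient -1 at \<open>a'\<close>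
      or at \<open>b'\<close>.\<close>
    have "\<not> wedge a' b' * wedge (- a') b' \<ge> 0" "\<not> wedge b' a' * wedge (- b') a' \<ge> 0"
      "\<not> wedge b' a' * wedge (a' - b') a' \<ge> 0" "\<not> wedge a' b' * wedge (b' - a') b' \<ge> 0"
      using 1 unfolding wedge_swap[of a' b'] wedge_minus_left wedge_diff_left wedge_self
      by (simp_all only: mult_minus_left mult_minus_right minus_minus diff_0_right diff_0)
    with sgn[OF t' sh(2)] sgn[OF t'' sh(1)]
    have "a \<noteq> - a'" "a \<noteq> - b'" "a \<noteq> a' - b'" "a \<noteq> b' - a'" by blast+
    ultimately consider "a = a'" | "a = b'" by blast
    then show ?thesis
    proof cases
      case 1
      then have "aligned a b' \<epsilon> m p t" using t' m(1) \<epsilon>' near\<epsilon> by (simp add: aligned_def)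
      with sh show ?thesis by blast
    next
      case 2
      then have "aligned a a' \<epsilon> m p t" using t'' m(1) \<epsilon>' near\<epsilon> by (simp add: aligned_def)
      with sh show ?thesis by blast
    qed
  qed
  note ex = this
  have "\<exists>b\<in>short. \<forall>\<epsilon>>0. \<exists>m p t. aligned a b \<epsilon> m p t"
  proof (rule finite_choice_at_all_scales[OF finite_short])
    show "\<exists>b\<in>short. \<exists>m p t. aligned a b \<epsilon> m p t" if "\<epsilon> > 0" for \<epsilon>
      using that by (rule ex)
    show "\<exists>m p t. aligned a b \<epsilon>' m p t" if "\<exists>m p t. aligned a b \<epsilon> m p t" "\<epsilon> \<le> \<epsilon>'" for b \<epsilon> \<epsilon>'
      using that aligned_mono by blast
  qed
  with a show ?thesis by blast
qed

section \<open>Persistence of a displacement and the contradiction\<close>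

lemma sum_not_vertex:
  assumes "wedge a b \<noteq> 0" "x \<in> {a, b}" "y \<in> {a, b}"
  shows "x + y \<notin> {0, a, b}"
proof
  assume xy: "x + y \<in> {0, a, b}"
  \<comment> \<open>The functional \<open>wedge _ (b - a)\<close> is 0 at the origin and
    \<open>wedge a b\<close> at both \<open>a\<close> and \<open>b\<close>, so it doubles on
    \<open>x + y\<close>.\<close>
  have h: "wedge a (b - a) = wedge a b" "wedge b (b - a) = wedge a b"
    by (simp_all add: wedge_def algebra_simps)
  have "wedge (x + y) (b - a) = 2 * wedge a b"
    using assms(2,3) h by (auto simp: wedge_add_left)
  moreover have "wedge (x + y) (b - a) \<in> {0, wedge a b}"
    using xy h by (auto simp: wedge_zero_left)
  ultimately show False using assms(1) by auto
qed

text \<open>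
  Both groupings of \<open>D (m1 + m2) i\<close> have to lie in the triangle of \<open>m1 + m2\<close>, which excludes
  a simultaneous move in both summands; so a displacement \<open>b\<close> of \<open>D m1\<close> survives a shift by \<open>m2\<close>
  unless \<open>D m2\<close> itself moves by \<open>b\<close>.
\<close>

lemma triangle_persists:
  assumes t1: "triangle m1 p1 a b" and t2: "triangle m2 p2 a b"
    and sum: "range (D (m1 + m2)) = {p1 + p2, p1 + p2 + a, p1 + p2 + b}"
    and i: "D m1 i = p1 + b" "D m2 i \<noteq> p2 + b"
  shows "D m2 i = p2" "D m1 (i + m2) = p1 + b"
proof -
  have ne: "wedge a b \<noteq> 0" using t1 by (auto simp: triangle_def)
  have split: "\<exists>c\<in>{0, a, b}. D m j = p + c" if "triangle m p a b" for m p j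
  proof -
    have "D m j \<in> {p, p + a, p + b}" using that by (auto simp: triangle_def)
    then show ?thesis by auto
  qed
  obtain c where c: "c \<in> {0, a, b}" "D m2 i = p2 + c" using split[OF t2] by blast
  obtain c' where c': "c' \<in> {0, a, b}" "D m2 (i + m1) = p2 + c'" using split[OF t2] by blast
  obtain d where d: "d \<in> {0, a, b}" "D m1 (i + m2) = p1 + d" using split[OF t1] by blast
  have "D (m1 + m2) i \<in> {p1 + p2, p1 + p2 + a, p1 + p2 + b}" using sum by blast
  moreover have s1: "D (m1 + m2) i = p1 + p2 + (b + c')"
    unfolding D_add i c' by (simp add: algebra_simps)
  ultimately have bc': "b + c' \<in> {0, a, b}" by (auto simp: add.assoc)
  then have "c' = 0" using sum_not_vertex[OF ne, of b c'] c'(1) by blast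
  have "D (m1 + m2) i = p1 + p2 + (c + d)"
    unfolding add.commute[of m1 m2] D_add c d by (simp add: algebra_simps)
  with s1 \<open>c' = 0\<close> have cd: "c + d = b" by simp
  have "c \<noteq> b" using i(2) c(2) by blast
  moreover have "c = a \<Longrightarrow> d = 0" using sum_not_vertex[OF ne, of c d] d(1) cd by blast
  ultimately have "c = 0" using c(1) cd by auto
  then show "D m2 i = p2" "D m1 (i + m2) = p1 + b" using c d cd by auto
qed

lemma no_low_complexity_walk: False
proof -
  obtain a b where a: "a \<in> short" and b: "b \<in> short"
    and al: "\<And>\<epsilon>. \<epsilon> > 0 \<Longrightarrow> \<exists>m p t. aligned a b \<epsilon> m p t"
    using aligned_triangle by blast
  have weights: "weight m p a b < 12 * t" "weight m p b a < 12 * t" "weight m p b a < 4 * (\<epsilon> * t)"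
    if "aligned a b \<epsilon> m p t" "\<epsilon> \<le> 1" for m p t \<epsilon>
  proof -
    have T: "triangle m p a b" and n: "near m p (t * of_int (fst a)) (t * of_int (snd a)) (\<epsilon> * t)"
      and "t > 0" using that by (auto simp: aligned_def)
    note n0 = near_scaled[OF n a \<open>t > 0\<close> that(2)]
    from weight_near_0[OF T n0 b] weight_near_0[OF triangle_swap[OF T] n0 a]
    show "weight m p a b < 12 * t" "weight m p b a < 12 * t" by linarith+
    \<comment> \<open>The main term is a multiple of \<open>wedge a a\<close>, so only the error
      term remains.\<close>
    have "\<bar>weight m p b a\<bar> < 4 * (\<epsilon> * t)"
      using weight_near[OF triangle_swap[OF T] n a] by (simp add: mult.commute mult.left_commute)
    then show "weight m p b a < 4 * (\<epsilon> * t)" by linarith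
  qed
  obtain m1 p1 t1 where al1: "aligned a b (1/100) m1 p1 t1" using al[of "1/100"] by auto
  define w where "w = min (weight m1 p1 a b) (weight m1 p1 b a)"
  have T1: "triangle m1 p1 a b" and "t1 < 1/100" "k dvd m1" using al1 by (auto simp: aligned_def)
  have "w > 0" using weight_pos[OF T1] weight_pos[OF triangle_swap[OF T1]] by (simp add: w_def)
  have w_le: "w \<le> weight m1 p1 a b" "w \<le> weight m1 p1 b a" by (auto simp: w_def)
  have w1: "weight m1 p1 a b < 12/100" "weight m1 p1 b a < 12/100"
    using weights(1,2)[OF al1] \<open>t1 < 1/100\<close> by simp_all
  \<comment> \<open>The factor 100 leaves room for two bounds: the weights of \<open>m2\<close> sum
    to less than \<open>24 * t < w\<close>, and \<open>J\<close> times the weight of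
    \<open>p2 + b\<close> stays below \<open>24 * \<epsilon> < w\<close>.\<close>
  define \<epsilon> where "\<epsilon> = w / 100"
  have \<epsilon>: "\<epsilon> > 0" "\<epsilon> \<le> 1/100" "100 * \<epsilon> = w" using \<open>w > 0\<close> w_le w1 by (auto simp: \<epsilon>_def)
  obtain m2 p2 t where al2: "aligned a b \<epsilon> m2 p2 t" using al \<epsilon>(1) by blast
  then have T2: "triangle m2 p2 a b" and t: "t < \<epsilon>" "t > 0" and m2: "k dvd m2" "m2 > 0"
    and near2: "near m2 p2 (t * of_int (fst a)) (t * of_int (snd a)) (\<epsilon> * t)"
    by (auto simp: aligned_def triangle_def)
  have "\<epsilon> \<le> 1" using \<epsilon> by simp
  note w2 = weights[OF al2 this]
  \<comment> \<open>The smaller displacement must come first in \<open>triangle_add\<close>, hence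
    the reversed order.\<close>
  have "range (D (m2 + m1)) = {p2 + p1, p2 + p1 + a, p2 + p1 + b}"
    by (rule triangle_add[OF m2(1) \<open>k dvd m1\<close> T2 T1]) (use w1 w2(1,2) w_le \<epsilon> t in linarith)+
  then have sum: "range (D (m1 + m2)) = {p1 + p2, p1 + p2 + a, p1 + p2 + b}"
    by (simp only: add.commute)
  \<comment> \<open>The offset per block of length \<open>m2\<close> is at least
    \<open>t / 2\<close> in some coordinate; \<open>J\<close> blocks accumulate 5/2, beyond the
    bound 2 of \<open>D_near_mean\<close>.\<close>
  define J where "J = nat \<lceil>5 / t\<rceil>"
  have "5 / t > 0" using t by simp
  then have J: "real J \<ge> 5 / t" "real J < 5 / t + 1" by (auto simp: J_def) linarith+
  then have Jt: "real J * t \<ge> 5" "real J * t < 6"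
    using t \<epsilon> by (auto simp: field_simps)
  have "J > 0" using Jt(1) by (cases J) auto
  have "\<exists>i. D m1 i = p1 + b \<and> (\<forall>j\<in>{..<J}. \<not> D m2 (i + j * m2) = p2 + b)"
  proof (rule has_mean_ex)
    show "has_mean (\<lambda>i. of_bool (D m1 i = p1 + b)) (weight m1 p1 b a)"
      by (rule weight_has_mean[OF triangle_swap[OF T1]])
    show "has_mean (\<lambda>i. of_bool (D m2 (i + j * m2) = p2 + b)) (weight m2 p2 b a)" for j
      by (rule has_mean_shift[OF weight_has_mean[OF triangle_swap[OF T2]]])
    have "real J * weight m2 p2 b a \<le> real J * (4 * (\<epsilon> * t))"
      using w2(3) by (intro mult_left_mono) auto
    also have "\<dots> = (real J * t) * (4 * \<epsilon>)" by simp
    also have "\<dots> \<le> 6 * (4 * \<epsilon>)" using Jt \<epsilon> by (intro mult_right_mono) auto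
    also have "\<dots> < weight m1 p1 b a" using w_le \<epsilon> by linarith
    finally show "(\<Sum>j\<in>{..<J}. weight m2 p2 b a) < weight m1 p1 b a" by simp
  qed simp
  then obtain i where i: "D m1 i = p1 + b" "\<And>j. j < J \<Longrightarrow> D m2 (i + j * m2) \<noteq> p2 + b" by blast
  \<comment> \<open>As \<open>D m2\<close> avoids \<open>p2 + b\<close> at each of these positions,
    \<open>triangle_persists\<close> carries \<open>p1 + b\<close> from block to block and forces
    each block to contribute exactly \<open>p2\<close>.\<close>
  have "D m1 (i + j * m2) = p1 + b \<and> fst (D (j * m2) i) = j * fst p2 \<and> snd (D (j * m2) i) = j * snd p2"
    if "j \<le> J" for j
    using that
  proof (induction j)
    case 0
    then show ?case using i by (simp add: D_def)
  next
    case (Suc j)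
    then have IH: "D m1 (i + j * m2) = p1 + b" "fst (D (j * m2) i) = j * fst p2"
      "snd (D (j * m2) i) = j * snd p2" and "j < J" by auto
    note step = triangle_persists[OF T1 T2 sum IH(1) i(2)[OF \<open>j < J\<close>]]
    have "D (Suc j * m2) i = D (j * m2) i + p2"
      using D_add[of "j * m2" m2 i] step(1) by (simp add: add.commute)
    then show ?case using step(2) IH by (simp add: algebra_simps)
  qed
  from this[OF order_refl] have DJ: "fst (D (J * m2) i) = J * fst p2" "snd (D (J * m2) i) = J * snd p2"
    by auto
  have bd: "\<bar>real (J * m2) * f - of_int (fst (D (J * m2) i))\<bar> \<le> 2"
    "\<bar>real (J * m2) * g - of_int (snd (D (J * m2) i))\<bar> \<le> 2"
    using D_near_mean[of "J * m2" "D (J * m2) i"] m2 \<open>J > 0\<close> by auto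
  \<comment> \<open>To be applied in a coordinate where \<open>a\<close> does not vanish,
    \<open>c\<close> being that coordinate of \<open>a\<close>.\<close>
  have far: False if "\<bar>real (J * m2) * x - of_int (int J * q)\<bar> \<le> 2"
    "\<bar>real m2 * x - of_int q - t * of_int c\<bar> < \<epsilon> * t" "c \<noteq> 0" for x :: real and q c :: int
  proof -
    have "\<bar>real_of_int c\<bar> \<ge> 1" using that(3) by linarith
    then have "t * \<bar>real_of_int c\<bar> \<ge> t * 1" using t by (intro mult_left_mono) auto
    then have "\<bar>t * real_of_int c\<bar> \<ge> t" using t by (simp only: abs_mult)
    moreover have "\<epsilon> * t \<le> 1/100 * t" using \<epsilon> t by (intro mult_right_mono) auto
    ultimately have "\<bar>real m2 * x - of_int q\<bar> \<ge> t / 2" using that(2) t(2) by linarith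
    then have "real J * \<bar>real m2 * x - of_int q\<bar> \<ge> real J * (t / 2)" by (intro mult_left_mono) auto
    moreover have "real J * \<bar>real m2 * x - of_int q\<bar> = \<bar>real J * (real m2 * x - of_int q)\<bar>"
      by (simp only: abs_mult abs_of_nat)
    moreover have "real J * (real m2 * x - of_int q) = real (J * m2) * x - of_int (int J * q)"
      by (simp add: algebra_simps)
    ultimately show False using that(1) Jt(1) by linarith
  qed
  have "a \<noteq> 0" using T2 by (auto simp: triangle_def wedge_def)
  then have "fst a \<noteq> 0 \<or> snd a \<noteq> 0" by (simp add: prod_eq_iff)
  then show False
    using far[OF bd(1)[unfolded DJ]] far[OF bd(2)[unfolded DJ]] near2 unfolding near_def by blast
qed

end

section \<open>Words over three letters\<close>

text \<open>The classes are the nonempty fibres of \<open>\<phi>\<close>, one for each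
  value.\<close>

lemma card_quotient_kernel:
  "card (S // {(u, v) \<in> S \<times> S. \<phi> u = \<phi> v}) = card (\<phi> ` S)"
proof -
  have "S // {(u, v) \<in> S \<times> S. \<phi> u = \<phi> v} = (\<lambda>z. {u \<in> S. z = \<phi> u}) ` \<phi> ` S"
    unfolding quotient_def by (auto simp: image_iff Image_def)
  moreover have "inj_on (\<lambda>z. {u \<in> S. z = \<phi> u}) (\<phi> ` S)"
    by (rule inj_onI) auto
  ultimately show ?thesis by (simp add: card_image)
qed

lemma length_three_letters:
  assumes "set u \<subseteq> {x, y, z}" "x \<noteq> y" "x \<noteq> z" "y \<noteq> z"
  shows "length u = count_list u x + count_list u y + count_list u z"
  using assms by (induction u) auto

text \<open>The length determines the third count.\<close>

lemma mset_eq_iff_count_list_two: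
  assumes "set u \<subseteq> {x, y, z}" "set v \<subseteq> {x, y, z}" "x \<noteq> y" "x \<noteq> z" "y \<noteq> z"
    and "length u = length v"
  shows "mset u = mset v \<longleftrightarrow> count_list u x = count_list v x \<and> count_list u y = count_list v y"
proof
  assume "count_list u x = count_list v x \<and> count_list u y = count_list v y"
  moreover from this have "count_list u z = count_list v z"
    using length_three_letters[OF assms(1,3,4,5)] length_three_letters[OF assms(2,3,4,5)] assms(6) by simp
  moreover have "count_list u c = count_list v c" if "c \<notin> {x, y, z}" for c
    using that assms(1,2) by (metis count_notin subsetD)
  ultimately show "mset u = mset v"
    by (intro multiset_eqI) (metis count_mset insertCI insertE emptyE)
qed (metis count_mset)

theorem theorem5:
  fixes A :: "'a set" and w :: "'a word"
  assumes "card A = 3"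
    and "range w \<subseteq> A"
    and "admits_letter_frequencies A w"
    and "\<exists>k>0. \<forall>n>0. abelian_complexity w (k * n) \<le> 3"
  shows "rationally_dependent A (letter_freq w)"
proof (rule ccontr)
  assume indep: "\<not> rationally_dependent A (letter_freq w)"
  obtain x y z where A: "A = {x, y, z}" and ne: "x \<noteq> y" "x \<noteq> z" "y \<noteq> z"
    using assms(1) by (auto simp: card_3_iff)
  obtain k where k: "k > 0" "\<And>n. n > 0 \<Longrightarrow> abelian_complexity w (k * n) \<le> 3"
    using assms(4) by blast
  have set: "set (subsequence w i j) \<subseteq> {x, y, z}" for i j
    using assms(2) A by auto
  have lim: "(\<lambda>n. real (count_list (prefix n w) c) / real n) \<longlonglongrightarrow> letter_freq w c"
    if "c \<in> A" for c
    using assms(3) that unfolding admits_letter_frequencies_def letter_freq_def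
    by (simp add: convergent_LIMSEQ_iff)
  \<comment> \<open>This relation lets the constant 1 in \<open>indep\<close> be traded for the
    third frequency.\<close>
  have sum1: "letter_freq w x + letter_freq w y + letter_freq w z = 1"
  proof (rule LIMSEQ_unique)
    show "(\<lambda>n. real (count_list (prefix n w) x) / real n + real (count_list (prefix n w) y) / real n
        + real (count_list (prefix n w) z) / real n)
      \<longlonglongrightarrow> letter_freq w x + letter_freq w y + letter_freq w z"
      by (intro tendsto_add lim) (auto simp: A)
    have "\<forall>\<^sub>F n in sequentially. 1 = real (count_list (prefix n w) x) / real n
        + real (count_list (prefix n w) y) / real n + real (count_list (prefix n w) z) / real n"
      using eventually_gt_at_top[of 0]
    proof eventually_elim
      case (elim n)
      have "real n = real (count_list (prefix n w) x) + count_list (prefix n w) y + count_list (prefix n w) z"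
        using length_three_letters[OF set ne, of 0 n] by simp
      then show ?case using elim by (simp add: add_divide_distrib[symmetric])
    qed
    then show "(\<lambda>n. real (count_list (prefix n w) x) / real n + real (count_list (prefix n w) y) / real n
        + real (count_list (prefix n w) z) / real n) \<longlonglongrightarrow> 1"
      by (rule Lim_transform_eventually[OF tendsto_const])
  qed
  define \<phi> :: "'a list \<Rightarrow> int \<times> int" where "\<phi> u = (int (count_list u x), int (count_list u y))" for u
  define P where "P n = \<phi> (prefix n w)" for n
  have P_diff: "P (i + m) - P i = \<phi> (subsequence w i (i + m))" for i m
    unfolding P_def \<phi>_def subsequence_append by simp
  have "low_complexity_walk P (letter_freq w x) (letter_freq w y) k"
  proof
    show "(\<lambda>n. real_of_int (fst (P n)) / real n) \<longlonglongrightarrow> letter_freq w x"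
      "(\<lambda>n. real_of_int (snd (P n)) / real n) \<longlonglongrightarrow> letter_freq w y"
      using lim A by (simp_all add: P_def \<phi>_def)
    show "P (Suc n) - P n \<in> {(0, 0), (1, 0), (0, 1)}" for n
      using P_diff[of n 1] ne by (auto simp: \<phi>_def)
    show "card (range (\<lambda>i. P (i + k * n) - P i)) \<le> 3" if "n > 0" for n
    proof -
      define S where "S = factors w (k * n)"
      have "{(u, v) \<in> S \<times> S. abelian_equiv u v} = {(u, v) \<in> S \<times> S. \<phi> u = \<phi> v}"
      proof -
        have "abelian_equiv u v \<longleftrightarrow> \<phi> u = \<phi> v" if "u \<in> S" "v \<in> S" for u v
        proof -
          from that obtain i j where "u = subsequence w i (i + k * n)" "v = subsequence w j (j + k * n)"
            unfolding S_def factors_def by blast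
          then have "set u \<subseteq> {x, y, z}" "set v \<subseteq> {x, y, z}" "length u = length v"
            using set by (simp_all only: subsequence_length)
          with ne show ?thesis
            unfolding abelian_equiv_def \<phi>_def by (simp add: mset_eq_iff_count_list_two)
        qed
        then show ?thesis by auto
      qed
      then have "card (\<phi> ` S) = abelian_complexity w (k * n)"
        unfolding abelian_complexity_def S_def[symmetric] by (simp only: card_quotient_kernel)
      moreover have "\<phi> ` S = range (\<lambda>i. P (i + k * n) - P i)"
        unfolding S_def factors_def P_diff by auto
      ultimately show ?thesis using k(2)[OF that] by simp
    qed
    show "c0 = 0 \<and> c1 = 0 \<and> c2 = 0"
      if "of_int c0 + of_int c1 * letter_freq w x + of_int c2 * letter_freq w y = 0" for c0 c1 c2
    proof (rule ccontr)
      assume nz: "\<not> ?thesis"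
      \<comment> \<open>Writing 1 as the sum of the three frequencies adds \<open>c0\<close> to
        every coefficient.\<close>
      define q :: "'a \<Rightarrow> rat" where
        "q = (\<lambda>i. of_int (if i = x then c0 + c1 else if i = y then c0 + c2 else c0))"
      have "\<exists>i\<in>A. q i \<noteq> 0"
        using nz ne by (auto simp: q_def A simp del: of_int_add)
      moreover have "(\<Sum>i\<in>A. of_rat (q i) * letter_freq w i)
          = of_int c0 * (letter_freq w x + letter_freq w y + letter_freq w z)
            + of_int c1 * letter_freq w x + of_int c2 * letter_freq w y"
        using ne by (simp add: A q_def algebra_simps del: of_int_add) (simp add: algebra_simps)
      then have "(\<Sum>i\<in>A. of_rat (q i) * letter_freq w i) = 0"
        using that unfolding sum1 by simp
      ultimately show False using indep unfolding rationally_dependent_def by blast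
    qed
  qed (rule k)
  then show False by (rule low_complexity_walk.no_low_complexity_walk)
qed

end
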